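(* For any integers $m,n,p$ such that $m\ge n\ge 2p-1\ge 1$ and $m>2p-1$, we have $$r_{m,n}\le \lambda^{(m)}_p\, r_{m-1,2p-1},$$ where $\lambda_p^{(m)}$ is the largest zero of the orthogonal polynomial $\pi_p^{(m)}$.
   Context: For integers $0\le n\le m$, $\Pi_{m,n}$ is the class of polynomials $P(z)=\sum_{k=0}^m \alpha_k \frac{z^k}{k!}$ with $\alpha_0=\dots=\alpha_n=1$ (the coefficients $\alpha_k$, $k>n$, being arbitrary complex numbers). The stability region of $P$ is $S_P=\{z\in\mathbb{C} : |P(z)|\le 1\}$, and $D_r=\{z\in\mathbb{C} : |z+r|\le r\}$ for real $r\ge 0$. For $P\in\Pi_{m,n}$ set $r(P)=\sup\{r : D_r\subset S_P\}$; the absolute stability radius is $r_{m,n}=\sup\{r(P) : P\in\Pi_{m,n}\}$. Let $d\mu^{(m)}(x)=\frac{m}{x^{m+1}}dx$ on $[1,\infty)$, with moments $\mathcal{M}_k=\int_1^\infty x^k\,d\mu^{(m)}(x)=\frac{m}{m-k}$ for $0\le k\le m-1$. For $2p-1<m$, $\pi_p^{(m)}$ denotes the degree-$p$ orthogonal polynomial with respect to $d\mu^{(m)}$ on $[1,\infty)$, given by the $(p+1)\times(p+1)$ determinant whose rows are $(\mathcal{M}_{i},\mathcal{M}_{i+1},\dots,\mathcal{M}_{i+p})$ for $i=0,\dots,p-1$, followed by the last row $(1,x,\dots,x^p)$. *)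

theory Defs
  imports "HOL-Analysis.Analysis" "Jordan_Normal_Form.Determinant"
begin

definition stab_polys :: "nat \<Rightarrow> nat \<Rightarrow> complex poly set" where
  "stab_polys m n =
     {P. \<exists>\<alpha>. (\<forall>k\<le>n. \<alpha> k = 1) \<and> P = (\<Sum>k\<le>m. monom (\<alpha> k / fact k) k)}"

definition stability_region :: "complex poly \<Rightarrow> complex set" where
  "stability_region P = {z. cmod (poly P z) \<le> 1}"

definition stability_disk :: "real \<Rightarrow> complex set" where
  "stability_disk r = {z. cmod (z + of_real r) \<le> r}"

text \<open>
  Both suprema are taken in the extended reals, where they always exist; this way the definition
  is meaningful before any boundedness has been shown (and it correctly gives the value
  \<^term>\<open>\<infinity>\<close> for the constant polynomial 1).
\<close>

definition stability_radius :: "complex poly \<Rightarrow> ereal" where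
  "stability_radius P =
     (SUP r\<in>{r. 0 \<le> r \<and> stability_disk r \<subseteq> stability_region P}. ereal r)"

definition abs_stability_radius :: "nat \<Rightarrow> nat \<Rightarrow> ereal" where
  "abs_stability_radius m n = (SUP P\<in>stab_polys m n. stability_radius P)"

definition pareto_measure :: "nat \<Rightarrow> real measure" where
  "pareto_measure m = density lborel (\<lambda>x. ennreal (indicator {1..} x * (real m / x ^ (m + 1))))"

definition pareto_moment :: "nat \<Rightarrow> nat \<Rightarrow> real" where
  "pareto_moment m k = (LINT x|pareto_measure m. x ^ k)"

text \<open>
  The moments are finite only for \<open>k < m\<close>; the determinant below uses those with
  \<open>k \<le> 2 * p - 1\<close>, so it is meaningful for \<open>2 * p - 1 < m\<close>. Its entries are polynomials in
  the indeterminate \<open>x\<close>, with \<^term>\<open>monom 1 j\<close> standing for \<open>x ^ j\<close>; rows and columns are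
  numbered from 0.
\<close>

definition pareto_orth_poly :: "nat \<Rightarrow> nat \<Rightarrow> real poly" where
  "pareto_orth_poly m p =
     Determinant.det (Matrix.mat (p + 1) (p + 1)
       (\<lambda>(i, j). if i < p then [:pareto_moment m (i + j):] else monom 1 j))"

definition largest_zero :: "nat \<Rightarrow> nat \<Rightarrow> real" where
  "largest_zero m p = Max {x. poly (pareto_orth_poly m p) x = 0}"

lemma pareto_moment_eq:
  assumes "k < m"
  shows "pareto_moment m k = real m / (real m - real k)"
proof -
  define d where "d = m - k"
  have d: "d > 0" "m = k + d" using assms by (auto simp: d_def)
  define f where "f = (\<lambda>x::real. real m / x ^ (d + 1))"
  define F where "F = (\<lambda>x::real. - (real m / real d) * inverse (x ^ d))"
  have eq: "indicator {1..} x * (real m / x ^ (m + 1)) * x ^ k = indicator {1..} x * f x" for x :: real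
    by (auto simp: indicator_def f_def d power_add)
  have "pareto_moment m k = (LINT x|lborel. indicator {1..} x * f x)"
    unfolding pareto_moment_def pareto_measure_def eq[symmetric]
    by (subst integral_density) (auto simp: indicator_def intro!: AE_I2)
  also have "\<dots> = enn2real (\<integral>\<^sup>+x. ennreal (indicator {1..} x * f x) \<partial>lborel)"
    by (rule integral_eq_nn_integral) (auto simp: f_def indicator_def)
  also have "(\<integral>\<^sup>+x. ennreal (indicator {1..} x * f x) \<partial>lborel) = (\<integral>\<^sup>+x. ennreal (f x) * indicator {1..} x \<partial>lborel)"
    by (intro nn_integral_cong) (auto simp: indicator_def)
  also have "\<dots> = ennreal (0 - F 1)"
  proof (rule nn_integral_FTC_atLeast)
    show "f \<in> borel_measurable borel" by (simp add: f_def)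
    show "(F \<longlongrightarrow> 0) at_top"
      unfolding F_def using d(1)
      by (intro tendsto_mult_right_zero tendsto_inverse_0_at_top filterlim_pow_at_top filterlim_ident)
    fix x :: real assume x: "1 \<le> x"
    then show "0 \<le> f x" by (simp add: f_def)
    obtain e where e: "d = Suc e" using d(1) by (cases d) auto
    have "x \<noteq> 0" "real d \<noteq> 0" using x d(1) by auto
    have "DERIV (\<lambda>x. x ^ d) x :> real d * x ^ e"
      using DERIV_pow[of d x] by (simp add: e)
    from DERIV_cmult[OF DERIV_inverse_fun[OF this], of "- (real m / real d)"]
    show "DERIV F x :> f x"
      unfolding F_def using \<open>x \<noteq> 0\<close> \<open>real d \<noteq> 0\<close>
      by (rule_tac DERIV_cong) (auto simp: f_def e divide_simps simp del: of_nat_Suc)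
  qed
  finally show ?thesis using d by (simp add: F_def)
qed

end

theory Submission
  imports Defs
    "HOL-Computational_Algebra.Fundamental_Theorem_Algebra"
    "Jordan_Normal_Form.Char_Poly"
begin

text \<open>
  Suppose \<open>P\<close> is bounded by 1 on the disk \<open>D\<^sub>r\<close>. Two operations turn it into a polynomial \<open>Q\<close> of the
  class with parameters \<open>m - 1\<close> and \<open>2 * p - 1\<close>.

  The first is the normalized polar derivative \<open>P(z) - z P'(z) / m\<close>, which multiplies the \<open>k\<close>-th coefficient by
  \<open>1 - k / m\<close> and so lowers the degree bound to \<open>m - 1\<close>. Since its pole 0 lies in \<open>D\<^sub>r\<close>,
  Laguerre's theorem shows that the polar derivative is again bounded by 1 on \<open>D\<^sub>r\<close>
  (\<open>stability_disk_polar_derivative_bound\<close>).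

  The second repairs the low-order coefficients. The factor \<open>1 - k / m\<close> is the reciprocal of the
  \<open>k\<close>-th moment \<open>m / (m - k)\<close>, and Gauss quadrature with the \<open>p\<close> zeros \<open>x\<close> of the orthogonal
  polynomial as nodes and nonnegative weights \<open>w\<^sub>x\<close> reproduces all moments up to order \<open>2 * p - 1\<close>
  (\<open>pareto_gauss_quadrature\<close>). Averaging the polar derivative over the dilations \<open>z \<mapsto> x z\<close> with these
  weights therefore gives a polynomial \<open>Q\<close> whose coefficients are the prescribed ones up to order
  \<open>2 * p - 1\<close> (\<open>stab_polys_quadrature_average\<close>).

  All nodes lie in \<open>(1, \<lambda>]\<close>, where \<open>\<lambda>\<close> is the largest zero. Hence each dilation maps
  \<open>D\<^bsub>r/\<lambda>\<^esub>\<close> into \<open>D\<^sub>r\<close>, and the convex combination \<open>Q\<close> is bounded by 1 on \<open>D\<^bsub>r/\<lambda>\<^esub>\<close>. This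
  says that \<open>r / \<lambda>\<close> is at most the radius on the right-hand side.
\<close>

section \<open>Laguerre's theorem and the polar derivative on a disk\<close>

lemma logarithmic_derivative_partial_fractions:
  fixes g :: "complex poly"
  assumes "g \<noteq> 0"
  obtains z :: "nat \<Rightarrow> complex"
  where "\<And>i. i < degree g \<Longrightarrow> poly g (z i) = 0"
    and "\<And>w. poly g w \<noteq> 0 \<Longrightarrow> poly (pderiv g) w = poly g w * (\<Sum>i<degree g. 1 / (w - z i))"
proof -
  obtain A where A: "size A = degree g" "g = Polynomial.smult (lead_coeff g) (\<Prod>x\<in>#A. [:-x, 1:])"
    using alg_closed_imp_factorization[OF assms] by blast
  obtain zs where zs: "mset zs = A" using ex_mset by blast
  define z where "z = (\<lambda>i. zs ! i)"
  define d where "d = degree g"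
  define c where "c = lead_coeff g"
  have len: "length zs = d" using A(1) zs d_def by auto
  have "(\<Prod>x\<in>#A. [:-x, 1:]) = prod_list (map (\<lambda>x. [:-x, 1:]) zs)"
    by (simp add: zs[symmetric] prod_mset_prod_list flip: mset_map)
  also have "\<dots> = (\<Prod>i<d. [:-z i, 1:])"
    by (simp add: prod.list_conv_set_nth len z_def atLeast0LessThan)
  finally have g: "g = Polynomial.smult c (\<Prod>i<d. [:-z i, 1:])" using A(2) by (simp add: c_def)
  have pg: "poly g w = c * (\<Prod>i<d. w - z i)" for w
    by (subst g) (simp add: poly_prod)
  show thesis
  proof (rule that[of z])
    show "poly g (z i) = 0" if "i < degree g" for i
      using that by (auto simp: pg d_def)
    show "poly (pderiv g) w = poly g w * (\<Sum>i<degree g. 1 / (w - z i))" if w: "poly g w \<noteq> 0" for w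
    proof -
      have nz: "w - z i \<noteq> 0" if "i < d" for i using w that by (auto simp: pg)
      have "poly (pderiv g) w = c * (\<Sum>i<d. \<Prod>j\<in>{..<d} - {i}. w - z j)"
        by (subst g) (simp add: pderiv_smult pderiv_prod poly_sum poly_prod pderiv_pCons)
      also have "(\<Sum>i<d. \<Prod>j\<in>{..<d} - {i}. w - z j) = (\<Sum>i<d. (\<Prod>j<d. w - z j) * (1 / (w - z i)))"
      proof (rule sum.cong[OF refl])
        fix i assume i: "i \<in> {..<d}"
        have "(\<Prod>j<d. w - z j) = (w - z i) * (\<Prod>j\<in>{..<d} - {i}. w - z j)"
          by (rule prod.remove) (use i in auto)
        thus "(\<Prod>j\<in>{..<d} - {i}. w - z j) = (\<Prod>j<d. w - z j) * (1 / (w - z i))"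
          using nz i by simp
      qed
      finally show ?thesis by (simp add: pg d_def sum_distrib_left mult.assoc)
    qed
  qed
qed

text \<open>
  Laguerre's theorem for the closed unit disk. If the polar derivative vanished at \<open>w\<close>, then
  \<open>1 / (\<zeta> - w)\<close> would be the average of the numbers \<open>1 / (z\<^sub>i - w)\<close> over the zeros \<open>z\<^sub>i\<close>, padded with
  zeros up to \<open>m\<close> terms when the degree is smaller than \<open>m\<close>. But \<open>x \<mapsto> 1 / (x - w)\<close> maps the exterior
  of the unit disk, with the point at infinity going to 0, onto the set where the quadratic function
  \<open>\<phi>\<close> below is less than 1. This function is convex because \<open>cmod w \<le> 1\<close>, so the average stays
  in that set, while the image of a point \<open>\<zeta>\<close> of the closed disk is outside.
\<close>

lemma laguerre_polar_derivative_nonzero: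
  fixes g :: "complex poly"
  assumes deg: "degree g \<le> m" and m: "m > 0"
    and nz: "\<And>x. cmod x \<le> 1 \<Longrightarrow> poly g x \<noteq> 0"
    and w: "cmod w \<le> 1" and \<zeta>: "cmod \<zeta> \<le> 1"
  shows "of_nat m * poly g w + (\<zeta> - w) * poly (pderiv g) w \<noteq> 0"
proof
  assume eq: "of_nat m * poly g w + (\<zeta> - w) * poly (pderiv g) w = 0"
  define d where "d = degree g"
  define G where "G = poly g w"
  define K where "K = 1 - (cmod w)\<^sup>2"
  have G0: "G \<noteq> 0" using nz w by (simp add: G_def)
  have ne: "\<zeta> \<noteq> w"
    using eq G0 m by (auto simp: G_def)
  have K0: "K \<ge> 0" using w by (simp add: K_def power_le_one)
  from nz[of 0] have "g \<noteq> 0" by auto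
  then obtain z where root: "\<And>i. i < d \<Longrightarrow> poly g (z i) = 0"
    and dg: "\<And>w. poly g w \<noteq> 0 \<Longrightarrow> poly (pderiv g) w = poly g w * (\<Sum>i<d. 1 / (w - z i))"
    unfolding d_def using logarithmic_derivative_partial_fractions by blast
  have out: "cmod (z i) > 1" if "i < d" for i
    using root[OF that] nz[of "z i"] by fastforce
  define \<phi> where "\<phi> = (\<lambda>u. K * (cmod u)\<^sup>2 - 2 * Re (w * u))"
  have phi: "\<phi> (1 / (x - w)) = 1 + (1 - (cmod x)\<^sup>2) / (cmod (x - w))\<^sup>2" if "x \<noteq> w" for x
  proof -
    define u where "u = 1 / (x - w)"
    have u: "x * u = 1 + w * u" and "u \<noteq> 0" using that by (auto simp: u_def field_simps)
    have "(cmod (1 + w * u))\<^sup>2 = 1 + 2 * Re (w * u) + (cmod w)\<^sup>2 * (cmod u)\<^sup>2"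
      using cmod_power2[of "1 + w*u"] cmod_power2[of "w*u"]
      by (simp add: norm_mult power2_eq_square algebra_simps)
    hence "(cmod x)\<^sup>2 * (cmod u)\<^sup>2 = 1 + 2 * Re (w * u) + (cmod w)\<^sup>2 * (cmod u)\<^sup>2"
      by (simp flip: u add: norm_mult power_mult_distrib)
    hence "\<phi> u = 1 + (1 - (cmod x)\<^sup>2) * (cmod u)\<^sup>2"
      by (simp add: \<phi>_def K_def algebra_simps)
    thus ?thesis by (simp add: u_def norm_divide power_divide)
  qed
  define u where "u = (\<lambda>i. 1 / (z i - w))"
  define v where "v = 1 / (\<zeta> - w)"
  have phiu: "\<phi> (u i) < 1" if "i < d" for i
  proof -
    have "z i \<noteq> w" using out[OF that] w by auto
    moreover have "(cmod (z i))\<^sup>2 > 1" using out[OF that] by (simp add: one_less_power)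
    ultimately show ?thesis unfolding u_def by (subst phi) (auto intro!: divide_neg_pos)
  qed
  have phiv: "\<phi> v \<ge> 1"
    unfolding v_def using ne \<zeta> by (subst phi) (auto simp: power_le_one)
  have "poly (pderiv g) w = - G * (\<Sum>i<d. u i)"
  proof -
    have "(\<Sum>i<d. 1 / (w - z i)) = - (\<Sum>i<d. u i)"
      unfolding u_def sum_negf[symmetric]
      by (intro sum.cong refl) (metis divide_minus_right minus_diff_eq)
    thus ?thesis using dg[of w] G0 by (simp add: G_def)
  qed
  with eq have "G * (of_nat m - (\<zeta> - w) * (\<Sum>i<d. u i)) = 0"
    by (simp add: G_def algebra_simps)
  hence mv: "(\<Sum>i<d. u i) = of_nat m * v"
    using G0 ne unfolding v_def mult_eq_0_iff by (auto simp: field_simps)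
  have "v \<noteq> 0" using ne by (simp add: v_def)
  hence d0: "d > 0" using mv m by (cases d) auto
  (* Convexity of the square of the modulus, in the form of the Cauchy-Schwarz inequality. *)
  have "(cmod (of_nat m * v))\<^sup>2 \<le> (\<Sum>i<d. cmod (u i))\<^sup>2"
    unfolding mv[symmetric] by (intro power_mono norm_sum) auto
  also have "\<dots> \<le> real d * (\<Sum>i<d. (cmod (u i))\<^sup>2)"
    using sum_squared_le_sum_of_squares[of "\<lambda>i. cmod (u i)" "{..<d}"]
    by (simp add: mult.commute)
  also have "\<dots> \<le> real m * (\<Sum>i<d. (cmod (u i))\<^sup>2)"
    using deg by (intro mult_right_mono sum_nonneg) (auto simp: d_def)
  finally have "real m * (real m * (cmod v)\<^sup>2) \<le> real m * (\<Sum>i<d. (cmod (u i))\<^sup>2)"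
    by (simp add: norm_mult power_mult_distrib power2_eq_square mult_ac)
  hence "real m * (cmod v)\<^sup>2 \<le> (\<Sum>i<d. (cmod (u i))\<^sup>2)" using m by simp
  from mult_left_mono[OF this K0]
  have "real m * \<phi> v \<le> K * (\<Sum>i<d. (cmod (u i))\<^sup>2) - 2 * Re (w * (of_nat m * v))"
    by (simp add: \<phi>_def algebra_simps)
  also have "\<dots> = (\<Sum>i<d. \<phi> (u i))"
    by (simp only: \<phi>_def mv[symmetric] sum_subtractf sum_distrib_left Re_sum)
  also have "\<dots> < (\<Sum>i<d. 1)"
    using phiu d0 by (intro sum_strict_mono) auto
  also have "\<dots> \<le> real m" using deg by (simp add: d_def)
  finally show False using phiv m by simp
qed

text \<open>
  The polar derivative, divided by \<open>m\<close>, is linear and fixes constants. Were its value \<open>c\<close> at \<open>w\<close> of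
  modulus greater than 1, then \<open>f - c\<close> would have no zero in the unit disk although its polar
  derivative vanishes at \<open>w\<close>, against Laguerre's theorem.
\<close>

lemma polar_derivative_bound:
  fixes f :: "complex poly"
  assumes deg: "degree f \<le> m" and m: "m > 0"
    and bound: "\<And>x. cmod x \<le> 1 \<Longrightarrow> cmod (poly f x) \<le> 1"
    and w: "cmod w \<le> 1" and \<zeta>: "cmod \<zeta> \<le> 1"
  shows "cmod (poly f w + (\<zeta> - w) * poly (pderiv f) w / of_nat m) \<le> 1"
proof (rule ccontr)
  define c where "c = poly f w + (\<zeta> - w) * poly (pderiv f) w / of_nat m"
  assume "\<not> ?thesis"
  hence c: "cmod c > 1" by (simp add: c_def)
  have "of_nat m * poly (f - [:c:]) w + (\<zeta> - w) * poly (pderiv (f - [:c:])) w \<noteq> 0"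
  proof (rule laguerre_polar_derivative_nonzero[OF _ m _ w \<zeta>])
    show "degree (f - [:c:]) \<le> m"
      using deg by (intro degree_diff_le) auto
    show "poly (f - [:c:]) x \<noteq> 0" if "cmod x \<le> 1" for x
      using bound[OF that] c by auto
  qed
  moreover have "of_nat m * (poly f w - c) + (\<zeta> - w) * poly (pderiv f) w = 0"
    using m by (simp add: c_def field_simps)
  ultimately show False by (simp add: pderiv_diff pderiv_pCons)
qed

text \<open>
  The substitution \<open>z = r (x - 1)\<close> maps the unit disk to \<open>D\<^sub>r\<close> and the pole \<open>\<zeta> = 1\<close> to \<open>z = 0\<close>.
\<close>

lemma stability_disk_polar_derivative_bound:
  fixes P :: "complex poly"
  assumes deg: "degree P \<le> m" and m: "m > 0" and r: "r \<ge> 0"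
    and stab: "stability_disk r \<subseteq> stability_region P"
    and z: "z \<in> stability_disk r"
  shows "cmod (poly P z - z * poly (pderiv P) z / of_nat m) \<le> 1"
proof (cases "r = 0")
  case True
  hence "z = 0" using z by (simp add: stability_disk_def)
  thus ?thesis using z stab by (auto simp: stability_region_def)
next
  case False
  define f where "f = pcompose P [:-of_real r, of_real r:]"
  define w where "w = z / of_real r + 1"
  have r0: "r > 0" using r False by simp
  have pf: "poly f x = poly P (of_real r * (x - 1))" for x
    by (simp add: f_def poly_pcompose algebra_simps)
  have zw: "of_real r * (w - 1) = z" using r0 by (simp add: w_def)
  have "poly (pderiv f) w = of_real r * poly (pderiv P) z"
    by (simp add: f_def pderiv_pcompose poly_pcompose pderiv_pCons algebra_simps flip: zw)
  moreover have "poly f w = poly P z" using pf zw by simp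
  moreover have "cmod (poly f w + (1 - w) * poly (pderiv f) w / of_nat m) \<le> 1"
  proof (rule polar_derivative_bound[OF _ m])
    show "degree f \<le> m" using deg r0 by (simp add: f_def degree_pcompose)
    have "w = (z + of_real r) / of_real r" using r0 by (simp add: w_def field_simps)
    thus "cmod w \<le> 1" using z r0 by (simp add: stability_disk_def norm_divide)
    show "cmod (poly f x) \<le> 1" if "cmod x \<le> 1" for x
    proof -
      have "of_real r * (x - 1) + of_real r = of_real r * x" by (simp add: algebra_simps)
      hence "of_real r * (x - 1) \<in> stability_disk r"
        using that r0 by (simp add: stability_disk_def norm_mult)
      thus ?thesis using stab pf by (auto simp: stability_region_def)
    qed
  qed auto
  moreover have "(1 - w) * (of_real r * poly (pderiv P) z) = - (z * poly (pderiv P) z)"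
    by (simp add: algebra_simps flip: zw)
  ultimately show ?thesis by simp
qed

section \<open>The moment functional\<close>

text \<open>
  On polynomials of degree less than \<open>m\<close> this is integration against the Pareto measure. Cutting the
  sum at \<open>m\<close>, and not at the degree of the argument, makes the functional linear on all polynomials.
\<close>

definition moment_functional :: "nat \<Rightarrow> real poly \<Rightarrow> real" where
  "moment_functional m q = (\<Sum>k<m. coeff q k * pareto_moment m k)"

lemma moment_functional_linear:
  "moment_functional m (p + q) = moment_functional m p + moment_functional m q"
  "moment_functional m (Polynomial.smult c q) = c * moment_functional m q"
  by (simp_all add: moment_functional_def sum.distrib sum_distrib_left algebra_simps)

lemma moment_functional_0 [simp]: "moment_functional m 0 = 0"
  by (simp add: moment_functional_def)

lemma moment_functional_sum:
  "moment_functional m (\<Sum>i\<in>I. f i) = (\<Sum>i\<in>I. moment_functional m (f i))"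
  by (induction I rule: infinite_finite_induct) (auto simp: moment_functional_linear)

lemma moment_functional_monom:
  "k < m \<Longrightarrow> moment_functional m (monom c k) = c * pareto_moment m k"
  by (simp add: moment_functional_def if_distrib [of "\<lambda>x. x * _"] sum.delta cong: if_cong)

text \<open>
  With \<open>t = 1 / x\<close>, integration against \<open>m / x ^ (m + 1)\<close> over \<open>[1, \<infinity>)\<close> becomes integration of
  \<open>m t ^ (m - 1) q(1 / t)\<close> over \<open>[0, 1]\<close>, and this integrand is a polynomial in \<open>t\<close> when the degree of
  \<open>q\<close> is less than \<open>m\<close>. Its antiderivative \<open>F\<close> vanishes at 0 and takes the value of the functional at 1;
  it is nondecreasing, and it is constant only if \<open>q\<close> vanishes on \<open>(1, \<infinity>)\<close>.
\<close>

lemma moment_functional_pos: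
  assumes deg: "degree q < m" and q: "q \<noteq> 0"
    and nonneg: "\<And>x. x \<ge> 1 \<Longrightarrow> poly q x \<ge> 0"
  shows "moment_functional m q > 0"
proof -
  define F where "F = (\<lambda>t::real. \<Sum>k<m. coeff q k * pareto_moment m k * t ^ (m - k))"
  define f where "f = (\<lambda>t::real. real m * t ^ (m - 1) * poly q (1 / t))"
  have F0: "F 0 = 0" unfolding F_def by (intro sum.neutral) (auto simp: power_0_left)
  have F1: "F 1 = moment_functional m q" by (simp add: F_def moment_functional_def)
  have deriv: "(F has_real_derivative f t) (at t)" if t: "t > 0" for t
  proof -
    have "(F has_real_derivative
        (\<Sum>k<m. coeff q k * pareto_moment m k * (real (m - k) * t ^ (m - k - 1)))) (at t)"
      unfolding F_def by (auto intro!: derivative_eq_intros sum.cong)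
    also have "(\<Sum>k<m. coeff q k * pareto_moment m k * (real (m - k) * t ^ (m - k - 1)))
        = (\<Sum>k<m. real m * t ^ (m - 1) * (coeff q k * (1 / t) ^ k))"
    proof (intro sum.cong refl)
      fix k assume "k \<in> {..<m}"
      hence k: "k < m" by simp
      have "t ^ (m - 1) * (1 / t) ^ k = t ^ (m - k - 1)"
        using t k by (simp add: power_divide power_diff[symmetric] diff_right_commute)
      moreover have "pareto_moment m k * real (m - k) = real m"
        using k by (simp add: pareto_moment_eq of_nat_diff)
      ultimately show "coeff q k * pareto_moment m k * (real (m - k) * t ^ (m - k - 1))
          = real m * t ^ (m - 1) * (coeff q k * (1 / t) ^ k)"
        by (metis (no_types, opaque_lifting) mult.assoc mult.commute)
    qed
    also have "\<dots> = f t"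
      unfolding f_def sum_distrib_left[symmetric] poly_altdef
      using deg by (intro arg_cong2[of _ _ _ _ "(*)"] refl sum.mono_neutral_right)
        (auto simp: coeff_eq_0)
    finally show ?thesis .
  qed
  have fpos: "f t \<ge> 0" if "0 < t" "t \<le> 1" for t
    using that by (auto simp: f_def intro!: mult_nonneg_nonneg nonneg)
  have cont: "continuous_on S F" for S
    unfolding F_def by (intro continuous_intros)
  have mono: "F a \<le> F b" if "0 \<le> a" "a \<le> b" "b \<le> 1" for a b
  proof (rule DERIV_nonneg_imp_increasing_open[OF \<open>a \<le> b\<close>])
    fix x assume "a < x" "x < b"
    thus "\<exists>y. (F has_real_derivative y) (at x) \<and> 0 \<le> y"
      using that deriv[of x] fpos[of x] by auto
  qed (rule cont)
  have "F 1 \<noteq> 0"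
  proof
    assume "F 1 = 0"
    hence Fz: "F t = 0" if "0 \<le> t" "t \<le> 1" for t
      using mono[of 0 t] mono[of t 1] that F0 by auto
    have "poly q x = 0" if x: "x > 1" for x
    proof -
      define t where "t = 1 / x"
      have t: "0 < t" "t < 1" using x by (auto simp: t_def)
      have "(F has_real_derivative 0) (at t)"
      proof (rule has_field_derivative_transform_within_open)
        show "((\<lambda>_. 0) has_real_derivative 0) (at t)" by simp
        show "open {0<..<1::real}" by simp
      qed (use t Fz in auto)
      with deriv[OF t(1)] have "f t = 0" using DERIV_unique by blast
      thus ?thesis using t deg by (simp add: f_def t_def)
    qed
    hence "{1<..} \<subseteq> {x. poly q x = 0}" by auto
    moreover have "finite {x. poly q x = 0}" using q by (rule poly_roots_finite)
    ultimately show False using infinite_Ioi finite_subset by blast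
  qed
  moreover have "F 1 \<ge> 0" using mono[of 0 1] F0 by simp
  ultimately show ?thesis using F1 by simp
qed

section \<open>Degree and orthogonality of the determinantal polynomial\<close>

definition hankel_matrix :: "nat \<Rightarrow> nat \<Rightarrow> real mat" where
  "hankel_matrix m p = Matrix.mat p p (\<lambda>(i, j). pareto_moment m (i + j))"

definition bordered_hankel_matrix :: "nat \<Rightarrow> nat \<Rightarrow> (nat \<Rightarrow> real) \<Rightarrow> real mat" where
  "bordered_hankel_matrix m p v =
     Matrix.mat (p + 1) (p + 1) (\<lambda>(i, j). if i < p then pareto_moment m (i + j) else v j)"

text \<open>
  Laplace expansion along the last row. Deleting that row removes its effect on the cofactors, so
  they are real numbers and may be computed with any real last row \<open>v\<close>; a suitable choice of \<open>v\<close> then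
  gives the orthogonality relations.
\<close>

lemma pareto_orth_poly_expansion:
  "pareto_orth_poly m p = (\<Sum>j\<le>p. monom (cofactor (bordered_hankel_matrix m p v) p j) j)"
proof -
  define A where "A = Matrix.mat (p + 1) (p + 1)
       (\<lambda>(i, j). if i < p then [:pareto_moment m (i + j):] else monom (1::real) j)"
  have A: "A \<in> carrier_mat (p + 1) (p + 1)" by (simp add: A_def)
  interpret lift: comm_ring_hom "\<lambda>c::real. [:c:]"
    by unfold_locales (auto simp: one_pCons)
  have cof: "cofactor A p j = [:cofactor (bordered_hankel_matrix m p v) p j:]" if "j < p + 1" for j
  proof -
    have "mat_delete A p j = map_mat (\<lambda>c. [:c:]) (mat_delete (bordered_hankel_matrix m p v) p j)"
      by (rule eq_matI) (auto simp: mat_delete_def A_def bordered_hankel_matrix_def)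
    hence "Determinant.det (mat_delete A p j)
        = [:Determinant.det (mat_delete (bordered_hankel_matrix m p v) p j):]"
      by simp
    moreover have "(-1) ^ n = [:(-1::real) ^ n:]" for n
      by (induction n) simp_all
    ultimately show ?thesis by (simp add: cofactor_def)
  qed
  have "pareto_orth_poly m p = (\<Sum>j<p + 1. A $$ (p, j) * cofactor A p j)"
    unfolding pareto_orth_poly_def A_def[symmetric] by (rule laplace_expansion_row[OF A]) simp
  also have "\<dots> = (\<Sum>j<p + 1. monom (cofactor (bordered_hankel_matrix m p v) p j) j)"
  proof (intro sum.cong refl)
    fix j assume "j \<in> {..<p + 1}"
    thus "A $$ (p, j) * cofactor A p j = monom (cofactor (bordered_hankel_matrix m p v) p j) j"
      using cof[of j] by (simp add: A_def mult.commute[of "monom 1 j"] smult_monom)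
  qed
  finally show ?thesis by (simp add: lessThan_Suc_atMost)
qed

text \<open>
  A vector in the kernel is the coefficient vector of a polynomial \<open>q\<close> of degree less than \<open>p\<close> that
  is orthogonal to all monomials of degree less than \<open>p\<close>, hence to itself, which positivity excludes.
\<close>

lemma det_hankel_matrix_nonzero:
  assumes p: "p > 0" and m: "2 * p - 1 < m"
  shows "Determinant.det (hankel_matrix m p) \<noteq> 0"
proof
  have H: "hankel_matrix m p \<in> carrier_mat p p" by (simp add: hankel_matrix_def)
  assume "Determinant.det (hankel_matrix m p) = 0"
  then obtain v where v: "v \<in> carrier_vec p" "v \<noteq> 0\<^sub>v p"
    and Hv: "hankel_matrix m p *\<^sub>v v = 0\<^sub>v p"
    using det_0_iff_vec_prod_zero_field[OF H] by blast
  define q where "q = (\<Sum>j<p. monom (vec_index v j) j)"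
  have cq: "coeff q j = (if j < p then vec_index v j else 0)" for j
    by (auto simp: q_def coeff_sum if_distrib sum.delta cong: if_cong)
  have deg: "degree q \<le> p - 1" by (rule degree_le) (auto simp: cq)
  have q0: "q \<noteq> 0"
  proof
    assume "q = 0"
    hence "vec_index v j = 0" if "j < p" for j using cq[of j] that by simp
    hence "v = 0\<^sub>v p" using v(1) by (intro eq_vecI) auto
    thus False using v(2) by simp
  qed
  have row: "moment_functional m (monom 1 i * q) = 0" if i: "i < p" for i
  proof -
    have "moment_functional m (monom 1 i * q) = (\<Sum>j<p. pareto_moment m (i + j) * vec_index v j)"
      unfolding q_def sum_distrib_left mult_monom moment_functional_sum
      using i m by (intro sum.cong refl) (subst moment_functional_monom; simp)
    also have "\<dots> = vec_index (hankel_matrix m p *\<^sub>v v) i"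
      using i v(1) by (simp add: hankel_matrix_def scalar_prod_def atLeast0LessThan)
    finally show ?thesis using i by (simp add: Hv)
  qed
  have "q * q = (\<Sum>i<p. Polynomial.smult (vec_index v i) (monom 1 i * q))"
    by (subst (1) q_def) (simp add: sum_distrib_right smult_monom flip: mult_smult_left)
  hence "moment_functional m (q * q) = 0"
    using row by (simp add: moment_functional_sum moment_functional_linear)
  moreover have "moment_functional m (q * q) > 0"
  proof (rule moment_functional_pos)
    show "degree (q * q) < m" using deg p m q0 by (simp add: degree_mult_eq)
  qed (use q0 in auto)
  ultimately show False by simp
qed

text \<open>
  The coefficient of \<open>x ^ p\<close> in the determinant is the Hankel determinant of size \<open>p\<close>.
\<close>

lemma degree_pareto_orth_poly:
  assumes "p > 0" and "2 * p - 1 < m"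
  shows "degree (pareto_orth_poly m p) = p"
proof (rule antisym)
  define c where "c = (\<lambda>j. cofactor (bordered_hankel_matrix m p (\<lambda>_. 0)) p j)"
  have expand: "pareto_orth_poly m p = (\<Sum>j\<le>p. monom (c j) j)"
    unfolding c_def by (rule pareto_orth_poly_expansion)
  show "degree (pareto_orth_poly m p) \<le> p"
    unfolding expand by (intro degree_sum_le) (auto intro: order.trans[OF degree_monom_le])
  have "mat_delete (bordered_hankel_matrix m p (\<lambda>_. 0)) p p = hankel_matrix m p"
    by (rule eq_matI) (auto simp: mat_delete_def bordered_hankel_matrix_def hankel_matrix_def)
  hence "c p \<noteq> 0"
    using det_hankel_matrix_nonzero[OF assms] by (simp add: c_def cofactor_def)
  moreover have "coeff (pareto_orth_poly m p) p = c p"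
    by (simp add: expand coeff_sum sum.delta)
  ultimately show "p \<le> degree (pareto_orth_poly m p)" by (intro le_degree) simp
qed

text \<open>
  Multiplying by \<open>x ^ k\<close> and applying the functional replaces the last row of the determinant by the
  moments of orders \<open>k, \<dots>, k + p\<close>, which are already row \<open>k\<close>.
\<close>

lemma pareto_orth_poly_orthogonal_monom:
  assumes k: "k < p" and m: "2 * p - 1 < m"
  shows "moment_functional m (pareto_orth_poly m p * monom 1 k) = 0"
proof -
  define B where "B = bordered_hankel_matrix m p (\<lambda>j. pareto_moment m (k + j))"
  have B: "B \<in> carrier_mat (p + 1) (p + 1)" by (simp add: B_def bordered_hankel_matrix_def)
  have "moment_functional m (pareto_orth_poly m p * monom 1 k)
      = (\<Sum>j\<le>p. pareto_moment m (k + j) * cofactor B p j)"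
    unfolding pareto_orth_poly_expansion[of m p "\<lambda>j. pareto_moment m (k + j)"] B_def[symmetric]
      sum_distrib_right mult_monom moment_functional_sum
    using k m by (intro sum.cong refl) (subst moment_functional_monom; simp add: add.commute)
  also have "\<dots> = (\<Sum>j<p + 1. B $$ (p, j) * cofactor B p j)"
    by (intro sum.cong) (auto simp: B_def bordered_hankel_matrix_def)
  also have "\<dots> = Determinant.det B"
    by (rule laplace_expansion_row[OF B, symmetric]) simp
  also have "\<dots> = 0"
  proof (rule det_identical_rows[OF B])
    show "Matrix.row B k = Matrix.row B p"
      using k by (intro eq_vecI) (auto simp: B_def bordered_hankel_matrix_def)
  qed (use k in auto)
  finally show ?thesis .
qed

lemma pareto_orth_poly_orthogonal:
  assumes s: "degree s < p" and m: "2 * p - 1 < m"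
  shows "moment_functional m (pareto_orth_poly m p * s) = 0"
proof -
  have "pareto_orth_poly m p * s =
      pareto_orth_poly m p * (\<Sum>k\<le>degree s. monom (coeff s k) k)"
    by (simp only: poly_as_sum_of_monoms)
  also have "\<dots> =
      (\<Sum>k\<le>degree s. Polynomial.smult (coeff s k) (pareto_orth_poly m p * monom 1 k))"
    unfolding sum_distrib_left mult_smult_right[symmetric] smult_monom by simp
  finally show ?thesis
    using s pareto_orth_poly_orthogonal_monom[OF _ m]
    by (simp add: moment_functional_sum moment_functional_linear)
qed

section \<open>Zeros of the orthogonal polynomial\<close>

lemma real_poly_irreducible_factor_cases:
  fixes s :: "real poly"
  assumes "degree s > 0"
  obtains (linear) a where "poly s a = 0"
  | (quadratic) a b where "b \<noteq> 0" "[:a\<^sup>2 + b\<^sup>2, -2 * a, 1:] dvd s"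
proof -
  interpret ev: map_poly_comm_ring_hom "of_real :: real \<Rightarrow> complex" ..
  define E where "E = (\<lambda>q::real poly. map_poly complex_of_real q)"
  have "degree (E s) > 0" using assms by (simp add: E_def)
  then obtain z where z: "poly (E s) z = 0"
    using fundamental_theorem_of_algebra constant_degree neq0_conv by blast
  define a b where "a = Re z" and "b = Im z"
  show thesis
  proof (cases "b = 0")
    case True
    hence "z = of_real a" by (simp add: a_def b_def complex_eq_iff)
    hence "poly s a = 0" using z by (simp add: E_def)
    thus thesis by (rule linear)
  next
    case False
    define Q where "Q = [:a\<^sup>2 + b\<^sup>2, -2 * a, 1:]"
    have Qz: "poly (E Q) z = 0"
      by (simp add: E_def Q_def a_def b_def complex_eq_iff power2_eq_square algebra_simps)
    have "E s = E Q * E (s div Q) + E (s mod Q)"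
      unfolding E_def ev.hom_mult[symmetric] ev.hom_add[symmetric] by simp
    hence rz: "poly (E (s mod Q)) z = 0" using z Qz by simp
    have "degree (s mod Q) < 2"
      using degree_mod_less[of Q s] by (auto simp: Q_def)
    then obtain c0 c1 where c: "s mod Q = [:c0, c1:]"
      by (metis One_nat_def Suc_1 degree1_coeffs degree_eq_zeroE less_2_cases pCons_0_0)
    have "c1 * b = 0" using arg_cong[OF rz, of Im]
      by (auto simp: c E_def b_def of_real_hom.map_poly_pCons_hom)
    hence "c1 = 0" using False by simp
    moreover from this have "c0 = 0" using arg_cong[OF rz, of Re]
      by (simp add: c E_def of_real_hom.map_poly_pCons_hom)
    ultimately have "Q dvd s" using c by (simp add: mod_eq_0_iff_dvd)
    thus thesis using quadratic[OF False] by (simp add: Q_def)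
  qed
qed

text \<open>
  Everything about the location of the zeros follows from this: write the orthogonal polynomial as
  \<open>h * s\<close> with \<open>h\<close> not constant. Then \<open>s\<close> has degree less than \<open>p\<close>, so the functional vanishes at
  \<open>(h * s) * s = h * s\<^sup>2\<close>. If \<open>h\<close> were nonnegative on \<open>[1, \<infinity>)\<close>, so would be \<open>h * s\<^sup>2\<close>, which has
  degree at most \<open>2 * p - 1 < m\<close>, and positivity of the functional would be violated.
\<close>

lemma pareto_orth_poly_factor_negative_somewhere:
  assumes p: "p > 0" and m: "2 * p - 1 < m"
    and dvd: "h dvd pareto_orth_poly m p" and h: "degree h > 0"
  obtains x where "x \<ge> 1" "poly h x < 0"
proof (rule ccontr)
  assume "\<not> thesis"
  hence nonneg: "\<forall>x\<ge>1. poly h x \<ge> 0" using that by (meson not_le)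
  obtain s where s: "pareto_orth_poly m p = h * s" using dvd by (elim dvdE)
  have deg: "degree (h * s) = p" using degree_pareto_orth_poly[OF p m] s by simp
  hence nz: "h \<noteq> 0" "s \<noteq> 0" using p by auto
  hence sum: "degree h + degree s = p" using deg by (simp add: degree_mult_eq)
  have "moment_functional m (h * s * s) = 0"
    using pareto_orth_poly_orthogonal[OF _ m, of s] sum h by (simp add: s)
  moreover have "moment_functional m (h * s * s) > 0"
  proof (rule moment_functional_pos)
    show "degree (h * s * s) < m" using nz sum h m by (simp add: degree_mult_eq)
  qed (use nz nonneg in \<open>auto simp: mult.assoc intro!: mult_nonneg_nonneg\<close>)
  ultimately show False by simp
qed

lemma pareto_orth_poly_root_gt_1:
  assumes "p > 0" and "2 * p - 1 < m" and "poly (pareto_orth_poly m p) x = 0"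
  shows "x > 1"
proof -
  have "[:-x, 1:] dvd pareto_orth_poly m p" using assms(3) by (simp add: poly_eq_0_iff_dvd)
  then obtain y where "y \<ge> 1" "poly [:-x, 1:] y < 0"
    using pareto_orth_poly_factor_negative_somewhere[OF assms(1,2)] by fastforce
  thus ?thesis by simp
qed

lemma prod_linear_factors_dvd:
  fixes q :: "'a::idom poly"
  assumes "finite X" and "\<And>x. x \<in> X \<Longrightarrow> poly q x = 0"
  shows "(\<Prod>x\<in>X. [:-x, 1:]) dvd q"
  using assms
proof (induction X rule: finite_induct)
  case (insert x X)
  from insert.IH[OF insert.prems] obtain s where s: "q = (\<Prod>x\<in>X. [:-x, 1:]) * s"
    unfolding dvd_def by blast
  have "poly (\<Prod>x\<in>X. [:-x, 1:]) x \<noteq> 0"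
    using insert.hyps by (auto simp: poly_prod)
  hence "poly s x = 0" using insert.prems[of x] by (simp add: s)
  then obtain t where "s = [:-x, 1:] * t" by (auto simp: poly_eq_0_iff_dvd elim: dvdE)
  hence "q = (\<Prod>x\<in>insert x X. [:-x, 1:]) * t"
    unfolding prod.insert[OF insert.hyps] by (simp only: s mult_ac)
  thus ?case by (rule dvdI)
qed simp

text \<open>
  A real polynomial of degree \<open>p\<close> without \<open>p\<close> distinct real zeros has, beyond the linear factors of those zeros,
  a further linear or irreducible quadratic factor. A further linear factor repeats a zero, so the
  polynomial is divisible by a square or by a positive quadratic, and neither is ever negative.
\<close>

lemma card_pareto_orth_poly_roots:
  assumes p: "p > 0" and m: "2 * p - 1 < m"
  shows "card {x. poly (pareto_orth_poly m p) x = 0} = p"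
proof (rule ccontr)
  define X where "X = {x. poly (pareto_orth_poly m p) x = 0}"
  define W where "W = (\<Prod>x\<in>X. [:-x, 1:])"
  assume "card {x. poly (pareto_orth_poly m p) x = 0} \<noteq> p"
  hence card: "card X \<noteq> p" by (simp add: X_def)
  have deg: "degree (pareto_orth_poly m p) = p" by (rule degree_pareto_orth_poly[OF p m])
  hence nz: "pareto_orth_poly m p \<noteq> 0" using p by auto
  have fin: "finite X" unfolding X_def using nz by (rule poly_roots_finite)
  obtain s where s: "pareto_orth_poly m p = W * s"
    using prod_linear_factors_dvd[OF fin, of "pareto_orth_poly m p"]
    by (auto simp: X_def W_def elim: dvdE)
  have "degree W = card X" by (simp add: W_def degree_prod_sum_eq)
  moreover have "degree W + degree s = p"
    using nz deg by (simp add: s degree_mult_eq)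
  ultimately have "degree s > 0" using card by linarith
  thus False
  proof (cases rule: real_poly_irreducible_factor_cases)
    case (linear a)
    hence "a \<in> X" by (simp add: X_def s)
    hence "[:-a, 1:] dvd W" unfolding W_def by (intro dvd_prodI fin)
    moreover have "[:-a, 1:] dvd s" using linear by (simp add: poly_eq_0_iff_dvd)
    ultimately have "[:-a, 1:] * [:-a, 1:] dvd pareto_orth_poly m p"
      unfolding s by (rule mult_dvd_mono)
    moreover have "degree ([:-a, 1:] * [:-a, 1:]) > 0" by simp
    ultimately obtain x where "poly ([:-a, 1:] * [:-a, 1:]) x < 0"
      using pareto_orth_poly_factor_negative_somewhere[OF p m] by blast
    thus False by (simp only: poly_mult not_square_less_zero)
  next
    case (quadratic a b)
    hence "[:a\<^sup>2 + b\<^sup>2, -2 * a, 1:] dvd pareto_orth_poly m p" by (simp add: s)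
    moreover have "degree [:a\<^sup>2 + b\<^sup>2, -2 * a, 1:] > 0" by simp
    ultimately obtain x where "poly [:a\<^sup>2 + b\<^sup>2, -2 * a, 1:] x < 0"
      using pareto_orth_poly_factor_negative_somewhere[OF p m] by blast
    moreover have "poly [:a\<^sup>2 + b\<^sup>2, -2 * a, 1:] x = (x - a)\<^sup>2 + b\<^sup>2"
      by (simp add: power2_eq_square algebra_simps)
    ultimately show False using sum_power2_ge_zero[of "x - a" b] by linarith
  qed
qed

section \<open>Gauss quadrature\<close>

definition lagrange_basis :: "'a::field set \<Rightarrow> 'a \<Rightarrow> 'a poly" where
  "lagrange_basis X x = (\<Prod>y\<in>X - {x}. Polynomial.smult (1 / (x - y)) [:-y, 1:])"

lemma poly_lagrange_basis:
  assumes "finite X" and "x \<in> X" and "y \<in> X"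
  shows "poly (lagrange_basis X x) y = (if y = x then 1 else 0)"
  using assms by (auto simp: lagrange_basis_def poly_prod simp flip: diff_divide_distrib
      intro!: prod.neutral)

lemma degree_lagrange_basis:
  assumes "finite X" and "x \<in> X"
  shows "degree (lagrange_basis X x) = card X - 1"
proof -
  have "degree (lagrange_basis X x) = (\<Sum>y\<in>X - {x}. degree (Polynomial.smult (1 / (x - y)) [:-y, 1:]))"
    unfolding lagrange_basis_def by (rule degree_prod_sum_eq) auto
  also have "\<dots> = (\<Sum>y\<in>X - {x}. 1)" by (intro sum.cong) auto
  finally show ?thesis using assms by simp
qed

lemma lagrange_interpolation:
  fixes q :: "'a::field poly"
  assumes "finite X" and "degree q < card X"
  shows "q = (\<Sum>x\<in>X. Polynomial.smult (poly q x) (lagrange_basis X x))"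
proof (rule poly_eqI_degree[where A = X])
  fix y assume y: "y \<in> X"
  have "(\<Sum>x\<in>X. poly q x * poly (lagrange_basis X x) y) = (\<Sum>x\<in>X. if x = y then poly q y else 0)"
    using assms y by (intro sum.cong) (auto simp: poly_lagrange_basis)
  thus "poly q y = poly (\<Sum>x\<in>X. Polynomial.smult (poly q x) (lagrange_basis X x)) y"
    using assms y by (simp add: poly_sum)
next
  show "degree (\<Sum>x\<in>X. Polynomial.smult (poly q x) (lagrange_basis X x)) < card X"
    using assms by (intro degree_sum_less)
      (auto simp: degree_lagrange_basis intro!: order.strict_trans1[OF degree_smult_le])
qed (use assms in auto)

text \<open>
  The weights are the values of the functional at the Lagrange basis polynomials. Division by the
  orthogonal polynomial \<open>\<pi>\<close> shows exactness: for degree at most \<open>2 * p - 1\<close> the quotient has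
  degree less than \<open>p\<close>, so its product with \<open>\<pi>\<close> is annihilated, and the remainder is interpolated at the zeros of \<open>\<pi>\<close>.
  Applying the rule to the square of a basis polynomial, of degree at most \<open>2 * p - 2\<close>, shows
  that its weight is the value of the functional at a square and therefore nonnegative.
\<close>

lemma pareto_gauss_quadrature:
  assumes p: "p > 0" and m: "2 * p - 1 < m"
  defines "X \<equiv> {x. poly (pareto_orth_poly m p) x = 0}"
  obtains w where "\<And>x. x \<in> X \<Longrightarrow> w x \<ge> 0"
    and "\<And>q. degree q \<le> 2 * p - 1 \<Longrightarrow> moment_functional m q = (\<Sum>x\<in>X. w x * poly q x)"
proof -
  define \<pi> where "\<pi> = pareto_orth_poly m p"
  define w where "w = (\<lambda>x. moment_functional m (lagrange_basis X x))"
  have deg: "degree \<pi> = p" unfolding \<pi>_def by (rule degree_pareto_orth_poly[OF p m])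
  hence nz: "\<pi> \<noteq> 0" using p by auto
  have fin: "finite X" unfolding X_def \<pi>_def[symmetric] using nz by (rule poly_roots_finite)
  have card: "card X = p" unfolding X_def by (rule card_pareto_orth_poly_roots[OF p m])
  have quad: "moment_functional m q = (\<Sum>x\<in>X. w x * poly q x)" if q: "degree q \<le> 2 * p - 1" for q
  proof -
    have "moment_functional m (\<pi> * (q div \<pi>)) = 0"
      unfolding \<pi>_def
    proof (rule pareto_orth_poly_orthogonal[OF _ m], fold \<pi>_def)
      show "degree (q div \<pi>) < p"
      proof (cases "q div \<pi> = 0")
        case False
        have "degree (q mod \<pi>) \<le> 2 * p - 1"
          using degree_mod_less[OF nz, of q] deg p by auto
        hence "degree (q - q mod \<pi>) \<le> 2 * p - 1" using q by (intro degree_diff_le)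
        moreover have "degree (q - q mod \<pi>) = p + degree (q div \<pi>)"
          using False nz deg by (simp add: minus_mod_eq_mult_div degree_mult_eq)
        ultimately show ?thesis using p by linarith
      qed (use p in simp)
    qed
    moreover have "moment_functional m (q mod \<pi>) = (\<Sum>x\<in>X. w x * poly q x)"
    proof -
      have "degree (q mod \<pi>) < card X"
        using degree_mod_less[OF nz, of q] deg p card by auto
      from arg_cong[OF lagrange_interpolation[OF fin this], of "moment_functional m"]
      have "moment_functional m (q mod \<pi>) = (\<Sum>x\<in>X. poly (q mod \<pi>) x * w x)"
        by (simp add: moment_functional_sum moment_functional_linear w_def)
      also have "\<dots> = (\<Sum>x\<in>X. w x * poly q x)"
        by (intro sum.cong) (auto simp: X_def \<pi>_def poly_mod)
      finally show ?thesis .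
    qed
    moreover have "moment_functional m q =
        moment_functional m (\<pi> * (q div \<pi>)) + moment_functional m (q mod \<pi>)"
      by (simp flip: moment_functional_linear)
    ultimately show ?thesis by simp
  qed
  have "w x \<ge> 0" if x: "x \<in> X" for x
  proof -
    define q where "q = lagrange_basis X x * lagrange_basis X x"
    have l0: "lagrange_basis X x \<noteq> 0"
      using poly_lagrange_basis[OF fin x x] by auto
    have degq: "degree q \<le> 2 * p - 2"
      using l0 by (simp add: q_def degree_mult_eq degree_lagrange_basis[OF fin x] card)
    have "w x = (\<Sum>y\<in>X. if y = x then w y else 0)" using fin x by simp
    also have "\<dots> = (\<Sum>y\<in>X. w y * poly q y)"
      using x fin by (intro sum.cong) (auto simp: q_def poly_lagrange_basis)
    also have "\<dots> = moment_functional m q" using degq by (intro quad[symmetric]) auto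
    also have "\<dots> > 0"
    proof (rule moment_functional_pos)
      show "degree q < m" using degq m by linarith
    qed (use l0 in \<open>auto simp: q_def\<close>)
    finally show ?thesis by simp
  qed
  thus thesis using quad by (rule that)
qed

section \<open>Comparison of the stability radii\<close>

text \<open>
  The disks \<open>D\<^sub>r\<close> are tangent to each other at 0, so dilation by \<open>t\<close> sends \<open>D\<^sub>r\<close> to
  \<open>D\<^bsub>t r\<^esub>\<close>, which is contained in every larger disk of the family.
\<close>

lemma stability_disk_scale:
  assumes "0 \<le> t" and "t \<le> s" and "z \<in> stability_disk r"
  shows "of_real t * z \<in> stability_disk (s * r)"
proof -
  have r: "cmod (z + of_real r) \<le> r" using assms(3) by (simp add: stability_disk_def)
  hence "r \<ge> 0" using norm_ge_zero order.trans by blast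
  have "cmod (of_real t * z + of_real (s * r))
      = cmod (of_real t * (z + of_real r) + of_real ((s - t) * r))"
    by (simp add: algebra_simps)
  also have "\<dots> \<le> t * cmod (z + of_real r) + \<bar>(s - t) * r\<bar>"
    using norm_triangle_ineq[of "of_real t * (z + of_real r)" "of_real ((s - t) * r)"]
      assms(1) by (simp only: norm_mult norm_of_real abs_of_nonneg)
  also have "\<dots> = t * cmod (z + of_real r) + (s - t) * r"
    using assms(2) \<open>r \<ge> 0\<close> by simp
  also have "\<dots> \<le> t * r + (s - t) * r" using r assms(1) by (simp add: mult_left_mono)
  finally show ?thesis by (simp add: stability_disk_def algebra_simps)
qed

text \<open>
  The polar derivative multiplies the coefficient of \<open>z ^ k\<close> by \<open>1 - k / m\<close>; the weighted average over
  dilations multiplies it by the \<open>k\<close>-th discrete moment, which undoes this for \<open>k \<le> l\<close>. The term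
  of order \<open>m\<close> is lost, whence the degree bound \<open>m - 1\<close>.
\<close>

lemma stab_polys_quadrature_average:
  assumes P: "P \<in> stab_polys m n" and l: "l \<le> n" "l < m" and fin: "finite X"
    and mom: "\<And>k. k \<le> l \<Longrightarrow> (\<Sum>x\<in>X. w x * x ^ k) = real m / (real m - real k)"
  obtains Q where "Q \<in> stab_polys (m - 1) l"
    and "\<And>z. poly Q z = (\<Sum>x\<in>X. of_real (w x) *
           (poly P (of_real x * z) - of_real x * z * poly (pderiv P) (of_real x * z) / of_nat m))"
proof -
  obtain \<alpha> where \<alpha>: "\<And>k. k \<le> n \<Longrightarrow> \<alpha> k = 1"
    and P_eq: "P = (\<Sum>k\<le>m. monom (\<alpha> k / fact k) k)"
    using P by (auto simp: stab_polys_def)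
  define \<beta> where "\<beta> = (\<lambda>k. \<alpha> k * (1 - of_nat k / of_nat m) * of_real (\<Sum>x\<in>X. w x * x ^ k))"
  define Q where "Q = (\<Sum>k\<le>m - 1. monom (\<beta> k / fact k) k)"
  have "\<beta> k = 1" if k: "k \<le> l" for k
  proof -
    have "of_nat m - of_nat k \<noteq> (0::complex)" using k l by auto
    moreover have "\<beta> k = (1 - of_nat k / of_nat m) * of_real (real m / (real m - real k))"
      using k l by (simp only: \<beta>_def \<alpha> mom mult_1_left)
    ultimately show ?thesis using l by (simp add: field_simps)
  qed
  hence "Q \<in> stab_polys (m - 1) l" by (auto simp: stab_polys_def Q_def)
  moreover have "poly Q z = (\<Sum>x\<in>X. of_real (w x) *
      (poly P (of_real x * z) - of_real x * z * poly (pderiv P) (of_real x * z) / of_nat m))" for z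
  proof -
    have defect: "poly P y - y * poly (pderiv P) y / of_nat m
        = (\<Sum>k\<le>m - 1. \<alpha> k / fact k * (1 - of_nat k / of_nat m) * y ^ k)" for y
    proof -
      have "y * poly (pderiv P) y = (\<Sum>k\<le>m. of_nat k * (\<alpha> k / fact k) * y ^ k)"
        unfolding P_eq pderiv_sum pderiv_monom poly_sum poly_monom sum_distrib_left
      proof (intro sum.cong refl)
        fix k show "y * (of_nat k * (\<alpha> k / fact k) * y ^ (k - 1)) = of_nat k * (\<alpha> k / fact k) * y ^ k"
          by (cases k) auto
      qed
      moreover have "poly P y = (\<Sum>k\<le>m. \<alpha> k / fact k * y ^ k)"
        by (simp add: P_eq poly_sum poly_monom)
      ultimately have "poly P y - y * poly (pderiv P) y / of_nat m
          = (\<Sum>k\<le>m. \<alpha> k / fact k * y ^ k - of_nat k * (\<alpha> k / fact k) * y ^ k / of_nat m)"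
        by (simp only: sum_divide_distrib sum_subtractf)
      also have "\<dots> = (\<Sum>k\<le>m. \<alpha> k / fact k * (1 - of_nat k / of_nat m) * y ^ k)"
        by (intro sum.cong refl) (simp add: field_simps)
      also have "\<dots> = (\<Sum>k\<le>m - 1. \<alpha> k / fact k * (1 - of_nat k / of_nat m) * y ^ k)"
        using l by (cases m) auto
      finally show ?thesis .
    qed
    have "poly Q z = (\<Sum>k\<le>m - 1. \<Sum>x\<in>X. of_real (w x) *
        (\<alpha> k / fact k * (1 - of_nat k / of_nat m) * (of_real x * z) ^ k))"
      unfolding Q_def poly_sum poly_monom
      by (intro sum.cong refl)
        (simp add: \<beta>_def power_mult_distrib sum_distrib_left sum_distrib_right
          sum_divide_distrib mult_ac)
    also have "\<dots> = (\<Sum>x\<in>X. \<Sum>k\<le>m - 1. of_real (w x) *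
        (\<alpha> k / fact k * (1 - of_nat k / of_nat m) * (of_real x * z) ^ k))"
      by (rule sum.swap)
    finally show ?thesis by (simp only: defect sum_distrib_left)
  qed
  ultimately show thesis by (rule that)
qed

theorem theorem4:
  fixes m n p :: nat
  assumes "m \<ge> n" and "n \<ge> 2 * p - 1" and "2 * p - 1 \<ge> 1" and "m > 2 * p - 1"
  shows "abs_stability_radius m n
           \<le> ereal (largest_zero m p) * abs_stability_radius (m - 1) (2 * p - 1)"
proof -
  have p: "p > 0" and m: "2 * p - 1 < m" "m > 0" using assms by auto
  define X where "X = {x. poly (pareto_orth_poly m p) x = 0}"
  define L where "L = largest_zero m p"
  have card: "card X = p" unfolding X_def by (rule card_pareto_orth_poly_roots[OF p m(1)])
  hence fin: "finite X" and ne: "X \<noteq> {}" using p card_ge_0_finite by force+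
  have X_gt: "x > 1" if "x \<in> X" for x
    using pareto_orth_poly_root_gt_1[OF p m(1)] that by (simp add: X_def)
  have L_Max: "L = Max X" by (simp add: L_def largest_zero_def X_def)
  have L_ge: "x \<le> L" if "x \<in> X" for x using that fin by (simp add: L_Max)
  have L1: "L > 1" using X_gt[OF Max_in[OF fin ne]] by (simp add: L_Max)
  obtain w where w: "\<And>x. x \<in> X \<Longrightarrow> w x \<ge> 0"
    and quad: "\<And>q. degree q \<le> 2 * p - 1 \<Longrightarrow> moment_functional m q = (\<Sum>x\<in>X. w x * poly q x)"
    using pareto_gauss_quadrature[OF p m(1)] unfolding X_def by blast
  have mom: "(\<Sum>x\<in>X. w x * x ^ k) = real m / (real m - real k)" if "k \<le> 2 * p - 1" for k
    using quad[of "monom 1 k"] that m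
    by (simp add: degree_monom_eq moment_functional_monom pareto_moment_eq poly_monom)
  have sum1: "(\<Sum>x\<in>X. w x) = 1" using mom[of 0] m by simp
  have "ereal r \<le> ereal L * abs_stability_radius (m - 1) (2 * p - 1)"
    if P: "P \<in> stab_polys m n" and r: "0 \<le> r" and stab: "stability_disk r \<subseteq> stability_region P"
    for P r
  proof -
    obtain Q where Q: "Q \<in> stab_polys (m - 1) (2 * p - 1)"
      and Q_eq: "\<And>z. poly Q z = (\<Sum>x\<in>X. of_real (w x) *
           (poly P (of_real x * z) - of_real x * z * poly (pderiv P) (of_real x * z) / of_nat m))"
      using stab_polys_quadrature_average[OF P assms(2) m(1) fin mom] by blast
    have degP: "degree P \<le> m"
      using P by (auto simp: stab_polys_def intro!: degree_sum_le order.trans[OF degree_monom_le])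
    have "stability_disk (r / L) \<subseteq> stability_region Q"
    proof
      fix z assume z: "z \<in> stability_disk (r / L)"
      have "cmod (poly Q z) \<le> (\<Sum>x\<in>X. w x)"
        unfolding Q_eq
      proof (rule sum_norm_le)
        fix x assume x: "x \<in> X"
        have "of_real x * z \<in> stability_disk r"
          using stability_disk_scale[OF _ L_ge[OF x] z] X_gt[OF x] L1 by simp
        from stability_disk_polar_derivative_bound[OF degP m(2) r stab this]
        show "cmod (of_real (w x) * (poly P (of_real x * z)
            - of_real x * z * poly (pderiv P) (of_real x * z) / of_nat m)) \<le> w x"
          using w[OF x] by (simp add: norm_mult mult_left_le)
      qed
      thus "z \<in> stability_region Q" by (simp add: stability_region_def sum1)
    qed
    hence "ereal (r / L) \<le> stability_radius Q"
      unfolding stability_radius_def using r L1 by (intro SUP_upper) auto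
    also have "\<dots> \<le> abs_stability_radius (m - 1) (2 * p - 1)"
      unfolding abs_stability_radius_def using Q by (rule SUP_upper)
    finally have "ereal L * ereal (r / L) \<le> ereal L * abs_stability_radius (m - 1) (2 * p - 1)"
      using L1 by (intro ereal_mult_left_mono) auto
    thus ?thesis using L1 by simp
  qed
  thus ?thesis
    unfolding L_def[symmetric] abs_stability_radius_def[of m n] stability_radius_def
    by (intro SUP_least) auto
qed

end
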